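(* Let $n\ge 1$. Suppose the pair $(T,r)$, where $T$ is a tree with $n$ vertices and $r$ is a vertex of $T$, maximizes the local mean subtree order $\mu_T(r)$ among all such pairs. Then $T$ is a broom, i.e., a tree consisting of a path together with leaves attached to one end of the path, and $r$ is the other end of the path.
   Context: A subtree of a tree $T$ is a (nonempty) induced connected subgraph of $T$. For a vertex $r$ of $T$, the local mean subtree order $\mu_T(r)$ is the average number of vertices of a subtree of $T$, averaged over all subtrees of $T$ that contain $r$. *)

theory Defs
  imports Complex_Main "Graph_Theory.Digraph_Component"
begin

text \<open>
  A finite simple graph is a \<^locale>\<open>pair_graph\<close>: every undirected edge is represented by its two
  opposite arcs. The library predicate \<^const>\<open>tree\<close> is not usable for such graphs, because it also
  forbids the closed walk that runs through an edge and back; a cycle of an undirected graph is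
  a cycle in the sense of the library that has length at least 3.
\<close>

definition undirected_tree :: "'a pair_pre_digraph \<Rightarrow> bool" where
  "undirected_tree T \<longleftrightarrow> pair_graph T \<and> connected (with_proj T) \<and>
     \<not> (\<exists>p. pre_digraph.cycle (with_proj T) p \<and> 3 \<le> length p)"

text \<open>Nonemptiness of subtrees is part of \<^const>\<open>connected\<close>.\<close>

definition subtrees :: "'a pair_pre_digraph \<Rightarrow> 'a pair_pre_digraph set" where
  "subtrees T = {S. induced_subgraph (with_proj S) (with_proj T) \<and> connected (with_proj S)}"

definition local_mean_subtree_order :: "'a pair_pre_digraph \<Rightarrow> 'a \<Rightarrow> real" where
  "local_mean_subtree_order T r =
     (\<Sum>S \<in> {S \<in> subtrees T. r \<in> pverts S}. real (card (pverts S))) /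
     real (card {S \<in> subtrees T. r \<in> pverts S})"

text \<open>
  \<open>broom T xs L\<close>: the graph \<open>T\<close> consists of the path with vertex sequence \<open>xs\<close> and of the
  set \<open>L\<close> of leaves, all of them attached to the end \<^term>\<open>last xs\<close> of that path. The path has at
  least one vertex; if it has exactly one, its two ends \<^term>\<open>hd xs\<close> and \<^term>\<open>last xs\<close> coincide
  and \<open>T\<close> is a star with centre \<^term>\<open>hd xs\<close>. The set \<open>L\<close> may be empty.
\<close>

definition broom :: "'a pair_pre_digraph \<Rightarrow> 'a list \<Rightarrow> 'a set \<Rightarrow> bool" where
  "broom T xs L \<longleftrightarrow> xs \<noteq> [] \<and> distinct xs \<and> finite L \<and> set xs \<inter> L = {} \<and>
     pverts T = set xs \<union> L \<and>
     (let E = {(xs ! i, xs ! Suc i) | i. Suc i < length xs} \<union> {last xs} \<times> L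
      in parcs T = E \<union> E\<inverse>)"

end

theory Submission
  imports Defs
begin

text \<open>
  For a rooted tree let \<open>N\<close> and \<open>R\<close> be the number and the total order of the subtrees containing
  the root, so that the local mean is \<open>R / N\<close>. A tree with maximal mean \<open>\<mu>\<close> maximises
  \<open>R - \<rho> N\<close> for \<open>\<rho> = \<mu>\<close>, and for every real \<open>\<rho>\<close> the maximisers of this functional are brooms.
  Indeed, if the root has degree 1, then the tree below it maximises \<open>R - (\<rho> - 1) N\<close>, and
  induction applies. If the root has degree at least 2 and some branch has at least two vertices,
  then the tree is not a maximiser, because one of two local modifications at that branch is better.
  In the remaining case the tree is a star.
\<close>

section \<open>Rooted trees built by grafting\<close>

text \<open>\<open>Graft q x\<close> joins the root of \<open>x\<close> by an edge to the root of \<open>q\<close>, which stays the root.\<close>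

datatype 'a rtree = Single 'a | Graft "'a rtree" "'a rtree"

primrec root_of :: "'a rtree \<Rightarrow> 'a" where
  "root_of (Single v) = v"
| "root_of (Graft q x) = root_of q"

primrec vset :: "'a rtree \<Rightarrow> 'a set" where
  "vset (Single v) = {v}"
| "vset (Graft q x) = vset q \<union> vset x"

primrec edges :: "'a rtree \<Rightarrow> 'a rel" where
  "edges (Single v) = {}"
| "edges (Graft q x) = edges q \<union> edges x \<union> {(root_of q, root_of x), (root_of x, root_of q)}"

primrec distinct_labels :: "'a rtree \<Rightarrow> bool" where
  "distinct_labels (Single v) = True"
| "distinct_labels (Graft q x) =
     (distinct_labels q \<and> distinct_labels x \<and> vset q \<inter> vset x = {})"

text \<open>\<open>num\<close> and \<open>tot\<close> are the number and the total order of the subtrees that contain the root.\<close>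

primrec num :: "'a rtree \<Rightarrow> real" where
  "num (Single v) = 1"
| "num (Graft q x) = num q * (1 + num x)"

primrec tot :: "'a rtree \<Rightarrow> real" where
  "tot (Single v) = 1"
| "tot (Graft q x) = tot q * (1 + num x) + num q * tot x"

definition to_graph :: "'a rtree \<Rightarrow> 'a pair_pre_digraph" where
  "to_graph t = \<lparr>pverts = vset t, parcs = edges t\<rparr>"

lemma to_graph_simps [simp]: "pverts (to_graph t) = vset t" "parcs (to_graph t) = edges t"
  by (simp_all add: to_graph_def)

lemma finite_vset [simp]: "finite (vset t)"
  by (induction t) auto

lemma root_of_in_vset [simp]: "root_of t \<in> vset t"
  by (induction t) auto

lemma edges_subset: "edges t \<subseteq> vset t \<times> vset t"
  by (induction t) auto

lemma sym_edges: "sym (edges t)"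
  by (induction t) (auto simp: sym_def)

lemma num_ge_1: "num t \<ge> 1"
proof (induction t)
  case (Graft q x)
  then show ?case
    using mult_mono[of 1 "num q" 1 "1 + num x"] by simp
qed simp

lemma num_ge_2: "num (Graft q x) \<ge> 2"
  using mult_mono[of 1 "num q" 2 "1 + num x"] num_ge_1[of q] num_ge_1[of x] by simp

text \<open>Apart from the root alone, every subtree counted has at least two vertices.\<close>

lemma tot_ge: "tot t \<ge> 2 * num t - 1"
proof (induction t)
  case (Graft q x)
  have B: "num q \<ge> 1" and a: "num x \<ge> 1"
    by (rule num_ge_1)+
  have "(2 * num q - 1) * (1 + num x) \<le> tot q * (1 + num x)"
    using Graft.IH(1) a by (intro mult_right_mono) auto
  moreover have "num q * (2 * num x - 1) \<le> num q * tot x"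
    using Graft.IH(2) B by (intro mult_left_mono) auto
  moreover have "1 * (2 * num x - 1) \<le> num q * (2 * num x - 1)"
    using a B by (intro mult_right_mono) auto
  ultimately show ?case
    using a by (simp add: algebra_simps)
qed simp

text \<open>Equality holds for a path rooted at one of its ends. In the induction step the two
  hypotheses combine to the factor \<open>num q + num x + 1\<close>, which is at most
  \<open>num q * (1 + num x) + 1\<close> because \<open>num q\<close> is at least 1.\<close>

lemma tot_le: "2 * tot t \<le> num t * (num t + 1)"
proof (induction t)
  case (Graft q x)
  have B: "num q \<ge> 1" and a: "num x \<ge> 1"
    by (rule num_ge_1)+
  have "2 * tot q * (1 + num x) \<le> num q * (num q + 1) * (1 + num x)"
    using Graft.IH(1) a by (intro mult_right_mono) auto
  moreover have "num q * (2 * tot x) \<le> num q * (num x * (num x + 1))"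
    using Graft.IH(2) B by (intro mult_left_mono) auto
  moreover have "num q * (1 + num x) * (num q + num x + 1) \<le>
                 num q * (1 + num x) * (num q * (1 + num x) + 1)"
    using B a mult_right_mono[of 1 "num q" "num x"]
    by (intro mult_left_mono) (auto simp: algebra_simps)
  ultimately show ?case
    by (simp add: algebra_simps)
qed simp

text \<open>\<open>glue x q\<close> identifies the root of \<open>q\<close> with the root of \<open>x\<close>, under the label of the latter.\<close>

primrec glue :: "'a rtree \<Rightarrow> 'a rtree \<Rightarrow> 'a rtree" where
  "glue x (Single v) = x"
| "glue x (Graft q b) = Graft (glue x q) b"

lemma root_of_glue [simp]: "root_of (glue x q) = root_of x"
  by (induction q) auto

lemma vset_glue:
  "distinct_labels q \<Longrightarrow> vset (glue x q) = vset x \<union> (vset q - {root_of q})"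
proof (induction q)
  case (Graft q b)
  have "root_of q \<notin> vset b"
    using Graft.prems root_of_in_vset[of q] by (auto simp del: root_of_in_vset)
  with Graft show ?case by auto
qed simp

lemma distinct_labels_glue:
  "distinct_labels x \<Longrightarrow> distinct_labels q \<Longrightarrow> vset x \<inter> vset q = {} \<Longrightarrow>
   distinct_labels (glue x q)"
  by (induction q) (auto simp: vset_glue)

lemma num_glue [simp]: "num (glue x q) = num x * num q"
  by (induction q) auto

text \<open>A subtree of the glued tree is a pair of rooted subtrees that share their root.
  Subtracting \<open>num q\<close> prevents this vertex from being counted twice.\<close>

lemma tot_glue [simp]: "tot (glue x q) = tot x * num q + num x * (tot q - num q)"
proof (induction q)
  case (Graft q b)
  show ?case by (simp add: Graft.IH(1)) (simp add: algebra_simps)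
qed simp

section \<open>Maximisers of a linear functional\<close>

text \<open>Fixing the label set, rather than only its size, lets a competitor replace a branch
  without a clash of labels.\<close>

definition maximal :: "real \<Rightarrow> 'a rtree \<Rightarrow> bool" where
  "maximal \<rho> t \<longleftrightarrow> distinct_labels t \<and>
     (\<forall>t'. distinct_labels t' \<and> vset t' = vset t \<longrightarrow>
        tot t' - \<rho> * num t' \<le> tot t - \<rho> * num t)"

inductive star :: "'a rtree \<Rightarrow> bool" where
  "star (Single v)"
| "star q \<Longrightarrow> star (Graft q (Single v))"

inductive broom_tree :: "'a rtree \<Rightarrow> bool" where
  "star t \<Longrightarrow> broom_tree t"
| "broom_tree t \<Longrightarrow> broom_tree (Graft (Single v) t)"

text \<open>
  With \<open>B\<close>, \<open>a\<close> the numbers and \<open>S\<close>, \<open>\<alpha>\<close> the total orders of \<open>q\<close> and \<open>x\<close>, the first competitor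
  (hang all branches of \<open>q\<close> below the root of \<open>x\<close>) gives \<open>\<rho> (B - 1) \<le> S - 1\<close>, the second one
  (move the branches of \<open>x\<close> to the root of \<open>q\<close>, leaving a leaf) gives
  \<open>S (a - 1) + B (\<alpha> - a) \<le> \<rho> (a - 1) B\<close>.
\<close>

lemma not_maximal_Graft_Graft:
  assumes q: "q = Graft q1 q2" and x: "x = Graft x1 x2"
  shows "\<not> maximal \<rho> (Graft q x)"
proof
  assume max: "maximal \<rho> (Graft q x)"
  define a B \<alpha> S where "a = num x" and "B = num q" and "\<alpha> = tot x" and "S = tot q"
  note defs = this
  have dq: "distinct_labels q" and dx: "distinct_labels x" and disj: "vset q \<inter> vset x = {}"
    using max by (auto simp: maximal_def)
  then have disj': "vset x \<inter> vset q = {}"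
    by blast
  have rq: "root_of q \<notin> vset x" and rx: "root_of x \<notin> vset q"
    using disj root_of_in_vset[of q] root_of_in_vset[of x] by blast+
  have a2: "a \<ge> 2" and B2: "B \<ge> 2"
    unfolding defs q x by (rule num_ge_2)+
  have \<alpha>: "\<alpha> - a \<ge> a - 1"
    using tot_ge[of x] by (simp add: defs)
  have S: "2 * (S - B) \<le> B * (B - 1)"
    using tot_le[of q] by (simp add: defs algebra_simps)
  let ?t1 = "Graft (Single (root_of q)) (glue x q)"
  have "distinct_labels ?t1 \<and> vset ?t1 = vset (Graft q x)"
    using dq dx disj disj' rq root_of_in_vset[of q] by (auto simp: distinct_labels_glue vset_glue)
  then have "tot ?t1 - \<rho> * num ?t1 \<le> tot (Graft q x) - \<rho> * num (Graft q x)"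
    using max unfolding maximal_def by blast
  then have 1: "\<rho> * (B - 1) \<le> S - 1"
    by (simp add: defs algebra_simps)
  let ?t2 = "Graft (glue q x) (Single (root_of x))"
  have "distinct_labels ?t2 \<and> vset ?t2 = vset (Graft q x)"
    using dq dx disj disj' rx root_of_in_vset[of x] by (auto simp: distinct_labels_glue vset_glue)
  then have "tot ?t2 - \<rho> * num ?t2 \<le> tot (Graft q x) - \<rho> * num (Graft q x)"
    using max unfolding maximal_def by blast
  then have 2: "S * (a - 1) + B * (\<alpha> - a) \<le> \<rho> * (a - 1) * B"
    by (simp add: defs algebra_simps)
  \<comment> \<open>The factor \<open>B - 1\<close> makes the first inequality applicable on the
    right-hand side, which eliminates \<rho>.\<close>
  have "(S * (a - 1) + B * (\<alpha> - a)) * (B - 1) \<le> \<rho> * (a - 1) * B * (B - 1)"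
    using 2 B2 by (intro mult_right_mono) auto
  also have "\<dots> = (\<rho> * (B - 1)) * ((a - 1) * B)"
    by simp
  also have "\<dots> \<le> (S - 1) * ((a - 1) * B)"
    using 1 a2 B2 by (intro mult_right_mono) auto
  finally have 3: "B * (B - 1) * (\<alpha> - a) \<le> (a - 1) * (S - B)"
    by (simp add: algebra_simps)
  \<comment> \<open>By the bounds on \<open>\<alpha> - a\<close> and \<open>S - B\<close>, the left
    side of \<open>3\<close> is at least \<open>B * (B - 1) * (a - 1)\<close> and the right side at
    most half of this positive number.\<close>
  have "B * (B - 1) * (a - 1) \<le> B * (B - 1) * (\<alpha> - a)"
    using \<alpha> B2 by (intro mult_left_mono) auto
  with 3 have "2 * (B * (B - 1) * (a - 1)) \<le> 2 * ((a - 1) * (S - B))"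
    by linarith
  also have "\<dots> = (a - 1) * (2 * (S - B))"
    by simp
  also have "\<dots> \<le> (a - 1) * (B * (B - 1))"
    using S a2 by (intro mult_left_mono) auto
  finally have "B * (B - 1) * (a - 1) \<le> 0"
    by (simp add: algebra_simps)
  moreover have "B * (B - 1) * (a - 1) > 0"
    using a2 B2 by simp
  ultimately show False by simp
qed

lemma maximal_cong:
  assumes "maximal \<rho> t" "distinct_labels t'" "vset t' = vset t" "num t' = num t" "tot t' = tot t"
  shows "maximal \<rho> t'"
  using assms by (simp add: maximal_def)

text \<open>Adding a root of degree 1 turns N and R into N + 1 and R + N + 1. The functional for
  \<rho> is therefore the one of \<open>x\<close> for \<open>\<rho> - 1\<close> plus the constant
  \<open>1 - \<rho>\<close>.\<close>

lemma maximal_Graft_SingleD: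
  assumes "maximal \<rho> (Graft (Single r) x)"
  shows "maximal (\<rho> - 1) x"
  unfolding maximal_def
proof (intro conjI allI impI)
  show "distinct_labels x"
    using assms by (simp add: maximal_def)
  fix x' assume x': "distinct_labels x' \<and> vset x' = vset x"
  then have "tot (Graft (Single r) x') - \<rho> * num (Graft (Single r) x') \<le>
             tot (Graft (Single r) x) - \<rho> * num (Graft (Single r) x)"
    using assms unfolding maximal_def by (auto simp del: tot.simps num.simps)
  then show "tot x' - (\<rho> - 1) * num x' \<le> tot x - (\<rho> - 1) * num x"
    by (simp add: algebra_simps)
qed

text \<open>Since the branches at the root may be reordered, a nontrivial branch can be put last.\<close>

lemma not_star_cases:
  assumes "\<not> star t" "distinct_labels t"
  obtains q x1 x2 where "distinct_labels (Graft q (Graft x1 x2))"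
    "vset (Graft q (Graft x1 x2)) = vset t" "num (Graft q (Graft x1 x2)) = num t"
    "tot (Graft q (Graft x1 x2)) = tot t" "\<And>r. q = Single r \<Longrightarrow> t = Graft q (Graft x1 x2)"
  using assms
proof (induction t arbitrary: thesis)
  case (Single v)
  then show ?case by (auto intro: star.intros)
next
  case (Graft q x)
  show ?case
  proof (cases x)
    case (Graft x1 x2)
    with Graft.prems show ?thesis by (intro Graft.prems(1)[of q x1 x2]) auto
  next
    case (Single v)
    have "\<not> star q"
      using Graft.prems(2) Single by (auto intro: star.intros)
    moreover have "distinct_labels q"
      using Graft.prems(3) by simp
    ultimately obtain q' x1 x2 where *: "distinct_labels (Graft q' (Graft x1 x2))"
      "vset (Graft q' (Graft x1 x2)) = vset q" "num (Graft q' (Graft x1 x2)) = num q"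
      "tot (Graft q' (Graft x1 x2)) = tot q"
      using Graft.IH(1) by metis
    \<comment> \<open>The leaf \<open>x\<close> is moved inwards past the nontrivial branch. The
      last condition holds vacuously, since \<open>Graft q' x\<close> is not a single
      vertex.\<close>
    show ?thesis
    proof (rule Graft.prems(1)[of "Graft q' x" x1 x2])
      show "vset (Graft (Graft q' x) (Graft x1 x2)) = vset (Graft q x)"
        using *(2) by auto
      show "distinct_labels (Graft (Graft q' x) (Graft x1 x2))"
        using * Graft.prems(3) by auto
      have "num (Graft (Graft q' x) X) = num (Graft q' X) * (1 + num x)" for X
        by (simp add: algebra_simps)
      then show "num (Graft (Graft q' x) (Graft x1 x2)) = num (Graft q x)"
        by (simp only: *(3) num.simps(2)[of q x])
      have "tot (Graft (Graft q' x) X) = tot (Graft q' X) * (1 + num x) + num (Graft q' X) * tot x" for X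
        by (simp add: algebra_simps)
      then show "tot (Graft (Graft q' x) (Graft x1 x2)) = tot (Graft q x)"
        by (simp only: *(3,4) tot.simps(2)[of q x])
    qed simp
  qed
qed

lemma maximal_imp_broom_tree: "maximal \<rho> t \<Longrightarrow> broom_tree t"
proof (induction "card (vset t)" arbitrary: t \<rho> rule: less_induct)
  case less
  show ?case
  proof (cases "star t")
    case True
    then show ?thesis by (rule broom_tree.intros)
  next
    case False
    have "distinct_labels t"
      using less.prems by (simp add: maximal_def)
    then obtain q x1 x2 where *: "distinct_labels (Graft q (Graft x1 x2))"
      "vset (Graft q (Graft x1 x2)) = vset t" "num (Graft q (Graft x1 x2)) = num t"
      "tot (Graft q (Graft x1 x2)) = tot t" "\<And>r. q = Single r \<Longrightarrow> t = Graft q (Graft x1 x2)"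
      using not_star_cases[OF False] by metis
    \<comment> \<open>The rearranged tree is maximal too, so its \<open>q\<close> must be a single
      vertex. The last property in \<open>*\<close> then identifies it with \<open>t\<close>
      itself.\<close>
    have "maximal \<rho> (Graft q (Graft x1 x2))"
      using maximal_cong[OF less.prems *(1-4)] .
    then obtain r where r: "q = Single r"
      using not_maximal_Graft_Graft by (cases q) blast+
    with *(5) have t: "t = Graft (Single r) (Graft x1 x2)"
      by simp
    have "card (vset (Graft x1 x2)) < card (vset t)"
      using \<open>distinct_labels t\<close> unfolding t by (intro psubset_card_mono) auto
    moreover have "maximal (\<rho> - 1) (Graft x1 x2)"
      using less.prems unfolding t by (rule maximal_Graft_SingleD)
    ultimately have "broom_tree (Graft x1 x2)"
      by (rule less.hyps)
    then show ?thesis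
      unfolding t by (rule broom_tree.intros)
  qed
qed

section \<open>Broom-shaped rooted trees as graphs\<close>

lemma star_edges:
  "star t \<Longrightarrow> distinct_labels t \<Longrightarrow>
   edges t = {root_of t} \<times> (vset t - {root_of t}) \<union> (vset t - {root_of t}) \<times> {root_of t}"
proof (induction rule: star.induct)
  case (2 q v)
  have v: "v \<noteq> root_of q"
    using "2.prems" root_of_in_vset[of q] by (auto simp del: root_of_in_vset)
  have E: "edges q = {root_of q} \<times> (vset q - {root_of q}) \<union> (vset q - {root_of q}) \<times> {root_of q}"
    using 2 by simp
  have V: "vset (Graft q (Single v)) - {root_of q} = insert v (vset q - {root_of q})"
    using v by auto
  show ?case
    unfolding root_of.simps V edges.simps E by blast
qed simp

text \<open>A star is a broom whose path has one vertex. Each further root of degree 1 becomes the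
  new head of the path and leaves its other end unchanged.\<close>

lemma broom_to_graph:
  assumes "broom_tree t" "distinct_labels t"
  shows "\<exists>xs L. broom (to_graph t) xs L \<and> hd xs = root_of t"
  using assms
proof (induction rule: broom_tree.induct)
  case (1 t)
  define L where "L = vset t - {root_of t}"
  have "edges t = {root_of t} \<times> L \<union> L \<times> {root_of t}"
    using 1 star_edges unfolding L_def by blast
  moreover have "vset t = insert (root_of t) L" "finite L" "root_of t \<notin> L"
    by (auto simp: L_def)
  ultimately have "broom (to_graph t) [root_of t] L"
    by (simp add: broom_def Let_def converse_Un converse_Times Un_commute)
  then show ?case by force
next
  case (2 t v)
  then obtain xs L where IH: "broom (to_graph t) xs L" and hd: "hd xs = root_of t"
    by auto
  then have xs: "xs \<noteq> []" and V: "vset t = set xs \<union> L"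
    by (simp_all add: broom_def)
  let ?P = "\<lambda>xs. {(xs ! i, xs ! Suc i) | i. Suc i < length xs}"
  have P: "?P (v # xs) = insert (v, root_of t) (?P xs)"
  proof (rule set_eqI)
    fix e
    show "e \<in> ?P (v # xs) \<longleftrightarrow> e \<in> insert (v, root_of t) (?P xs)"
    proof
      assume "e \<in> ?P (v # xs)"
      then obtain i where "e = ((v # xs) ! i, (v # xs) ! Suc i)" "Suc i < length (v # xs)"
        by blast
      then show "e \<in> insert (v, root_of t) (?P xs)"
        using hd xs by (cases i) (auto simp: hd_conv_nth)
    next
      assume "e \<in> insert (v, root_of t) (?P xs)"
      then consider "e = (v, root_of t)" | i where "e = (xs ! i, xs ! Suc i)" "Suc i < length xs"
        by blast
      then show "e \<in> ?P (v # xs)"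
      proof cases
        case 1
        with hd xs show ?thesis by (auto intro!: exI[of _ 0] simp: hd_conv_nth)
      next
        case 2
        then show ?thesis by (auto intro!: exI[of _ "Suc i"])
      qed
    qed
  qed
  have "edges t = ?P xs \<union> {last xs} \<times> L \<union> (?P xs \<union> {last xs} \<times> L)\<inverse>"
    using IH by (simp add: broom_def Let_def)
  then have "edges (Graft (Single v) t) =
      ?P (v # xs) \<union> {last (v # xs)} \<times> L \<union> (?P (v # xs) \<union> {last (v # xs)} \<times> L)\<inverse>"
    unfolding P using xs by auto
  moreover have "v \<notin> set xs" "v \<notin> L"
    using 2 V by auto
  ultimately have "broom (to_graph (Graft (Single v) t)) (v # xs) L"
    using IH by (auto simp: broom_def Let_def simp del: edges.simps)
  then show ?case by force
qed

section \<open>Subtrees containing the root\<close>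

text \<open>The closure of \<open>F\<close> in the assumption allows \<open>f\<close> to contract
  edges. This is used to retract walks in a \<open>Graft\<close> onto one of its two parts.\<close>

lemma rtrancl_map:
  assumes "(u, v) \<in> E\<^sup>*" and "\<And>a b. (a, b) \<in> E \<Longrightarrow> (f a, f b) \<in> F\<^sup>*"
  shows "(f u, f v) \<in> F\<^sup>*"
  using assms(1)
proof (induction rule: rtrancl_induct)
  case (step y z)
  with assms(2) show ?case by (meson rtrancl_trans)
qed simp

text \<open>For a symmetric \<open>E\<close> these are the vertex sets of the subtrees containing
  \<open>r\<close>: reachability from \<open>r\<close> alone already gives connectedness.\<close>

definition rooted_sets :: "'a rel \<Rightarrow> 'a \<Rightarrow> 'a set set" where
  "rooted_sets E r = {W. r \<in> W \<and> (\<forall>u\<in>W. (r, u) \<in> (E \<inter> W \<times> W)\<^sup>*)}"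

lemma rooted_sets_subset:
  assumes "W \<in> rooted_sets (edges t) (root_of t)"
  shows "W \<subseteq> vset t"
proof
  fix u assume "u \<in> W"
  with assms have "(root_of t, u) \<in> (edges t \<inter> W \<times> W)\<^sup>*"
    by (simp add: rooted_sets_def)
  then show "u \<in> vset t"
    by (cases rule: rtranclE) (use edges_subset[of t] in auto)
qed

lemma finite_rooted_sets: "finite (rooted_sets (edges t) (root_of t))"
  by (rule finite_subset[of _ "Pow (vset t)"]) (auto dest: rooted_sets_subset)

text \<open>A subtree through the root meets \<open>q\<close> in a subtree through the root of
  \<open>q\<close>. It either misses \<open>x\<close> or enters it through the joining edge, hence
  through the root of \<open>x\<close>; the empty set stands for missing \<open>x\<close>.\<close>

lemma rooted_sets_Graft:
  assumes "distinct_labels (Graft q x)"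
  shows "rooted_sets (edges (Graft q x)) (root_of q) =
    (\<lambda>(W, X). W \<union> X) ` (rooted_sets (edges q) (root_of q) \<times> insert {} (rooted_sets (edges x) (root_of x)))"
    (is "?L = ?R")
proof
  have disj: "vset q \<inter> vset x = {}"
    using assms by simp
  then have roots: "root_of q \<notin> vset x" "root_of x \<notin> vset q"
    using root_of_in_vset[of q] root_of_in_vset[of x] by blast+
  note sub = edges_subset[of q] edges_subset[of x]
  show "?L \<subseteq> ?R"
  proof
    fix W assume W: "W \<in> ?L"
    define A X where "A = W \<inter> vset q" and "X = W \<inter> vset x"
    have AX: "W = A \<union> X"
      using rooted_sets_subset[of W "Graft q x"] W by (auto simp: A_def X_def)
    have reach: "(root_of q, u) \<in> (edges (Graft q x) \<inter> W \<times> W)\<^sup>*" if "u \<in> W" for u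
      using W that by (simp add: rooted_sets_def)
    have rW: "root_of q \<in> W"
      using W by (simp add: rooted_sets_def)
    \<comment> \<open>Each map retracts the whole tree onto one part by sending the other part to
      the root of this one. The joining edge is contracted, and \<open>?g\<close> moves the start of
      a walk from the root of \<open>q\<close> to that of \<open>x\<close>.\<close>
    let ?f = "\<lambda>u. if u \<in> vset q then u else root_of q"
    let ?g = "\<lambda>u. if u \<in> vset x then u else root_of x"
    have "(root_of q, u) \<in> (edges q \<inter> A \<times> A)\<^sup>*" if "u \<in> A" for u
    proof -
      have "(?f (root_of q), ?f u) \<in> (edges q \<inter> A \<times> A)\<^sup>*"
      proof (rule rtrancl_map[OF reach])
        show "u \<in> W" using that by (simp add: A_def)
      next
        fix a b assume "(a, b) \<in> edges (Graft q x) \<inter> W \<times> W"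
        then show "(?f a, ?f b) \<in> (edges q \<inter> A \<times> A)\<^sup>*"
          using disj sub roots unfolding A_def by auto
      qed
      with that show ?thesis by (simp add: A_def)
    qed
    then have A: "A \<in> rooted_sets (edges q) (root_of q)"
      using rW by (simp add: rooted_sets_def A_def)
    have X: "(root_of x, u) \<in> (edges x \<inter> X \<times> X)\<^sup>*" if "u \<in> X" for u
    proof -
      have "(?g (root_of q), ?g u) \<in> (edges x \<inter> X \<times> X)\<^sup>*"
      proof (rule rtrancl_map[OF reach])
        show "u \<in> W" using that by (simp add: X_def)
      next
        fix a b assume "(a, b) \<in> edges (Graft q x) \<inter> W \<times> W"
        then show "(?g a, ?g b) \<in> (edges x \<inter> X \<times> X)\<^sup>*"
          using disj sub roots unfolding X_def by auto
      qed
      with roots that show ?thesis by (simp add: X_def)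
    qed
    have "X = {} \<or> X \<in> rooted_sets (edges x) (root_of x)"
    proof (cases "X = {}")
      case False
      then obtain u where u: "u \<in> X" by blast
      \<comment> \<open>The walk from the root of \<open>x\<close> to \<open>u\<close> is trivial or
        its first edge starts inside \<open>X\<close>; either way the root of \<open>x\<close> lies
        in \<open>X\<close>.\<close>
      have "root_of x \<in> X"
        using X[OF u] by (cases rule: converse_rtranclE) (use u in auto)
      with X show ?thesis by (simp add: rooted_sets_def)
    qed simp
    with A AX show "W \<in> ?R" by auto
  qed
  show "?R \<subseteq> ?L"
  proof
    fix W assume "W \<in> ?R"
    then obtain A X where W: "W = A \<union> X" and A: "A \<in> rooted_sets (edges q) (root_of q)"
      and X: "X = {} \<or> X \<in> rooted_sets (edges x) (root_of x)"
      by auto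
    let ?E = "edges (Graft q x) \<inter> W \<times> W"
    have q: "(root_of q, u) \<in> ?E\<^sup>*" if "u \<in> A" for u
    proof -
      have "(root_of q, u) \<in> (edges q \<inter> A \<times> A)\<^sup>*"
        using A that by (simp add: rooted_sets_def)
      then show ?thesis
        by (rule rtrancl_mono[THEN subsetD, rotated]) (auto simp: W)
    qed
    have x: "(root_of q, u) \<in> ?E\<^sup>*" if "u \<in> X" for u
    proof -
      have X': "X \<in> rooted_sets (edges x) (root_of x)"
        using X that by blast
      then have "(root_of x, u) \<in> (edges x \<inter> X \<times> X)\<^sup>*"
        using that by (simp add: rooted_sets_def)
      then have "(root_of x, u) \<in> ?E\<^sup>*"
        by (rule rtrancl_mono[THEN subsetD, rotated]) (auto simp: W)
      moreover have "(root_of q, root_of x) \<in> ?E"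
        using A X' by (auto simp: rooted_sets_def W)
      ultimately show ?thesis
        by (rule converse_rtrancl_into_rtrancl[rotated])
    qed
    show "W \<in> ?L"
      using A q x unfolding rooted_sets_def by (auto simp: W simp del: edges.simps)
  qed
qed

text \<open>Forming unions is injective and the two parts are disjoint, so counts multiply and
  orders add. The empty set contributes 1 to the count for \<open>x\<close> and 0 to its total
  order, as in the recursions for \<open>num\<close> and \<open>tot\<close>.\<close>

lemma card_rooted_sets:
  assumes "distinct_labels t"
  shows "real (card (rooted_sets (edges t) (root_of t))) = num t \<and>
         (\<Sum>W\<in>rooted_sets (edges t) (root_of t). real (card W)) = tot t"
  using assms
proof (induction t)
  case (Single v)
  have "rooted_sets {} v = {{v}}"
    by (auto simp: rooted_sets_def)
  then show ?case by simp
next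
  case (Graft q x)
  let ?Q = "rooted_sets (edges q) (root_of q)" and ?X = "rooted_sets (edges x) (root_of x)"
  have fin: "finite ?Q" "finite ?X"
    by (rule finite_rooted_sets)+
  have disj: "vset q \<inter> vset x = {}"
    using Graft.prems by simp
  have inj: "inj_on (\<lambda>(W, X). W \<union> X) (?Q \<times> insert {} ?X)"
  proof (rule inj_onI, clarify)
    fix W X W' X'
    assume "W \<in> ?Q" "X \<in> insert {} ?X" "W' \<in> ?Q" "X' \<in> insert {} ?X" and eq: "W \<union> X = W' \<union> X'"
    then have "W \<subseteq> vset q" "X \<subseteq> vset x" "W' \<subseteq> vset q" "X' \<subseteq> vset x"
      using rooted_sets_subset by blast+
    with disj eq show "W = W' \<and> X = X'" by blast
  qed
  have empty: "{} \<notin> ?X"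
    by (simp add: rooted_sets_def)
  have "real (card (rooted_sets (edges (Graft q x)) (root_of q))) = real (card ?Q) * (1 + real (card ?X))"
    unfolding rooted_sets_Graft[OF Graft.prems] card_image[OF inj]
    using fin empty by (simp add: card_cartesian_product algebra_simps)
  moreover have "(\<Sum>W\<in>rooted_sets (edges (Graft q x)) (root_of q). real (card W)) =
     (\<Sum>W\<in>?Q. real (card W)) * (1 + real (card ?X)) + real (card ?Q) * (\<Sum>X\<in>?X. real (card X))"
  proof -
    have "(\<Sum>W\<in>rooted_sets (edges (Graft q x)) (root_of q). real (card W)) =
          (\<Sum>(W, X)\<in>?Q \<times> insert {} ?X. real (card (W \<union> X)))"
      unfolding rooted_sets_Graft[OF Graft.prems] sum.reindex[OF inj]
      by (simp add: case_prod_unfold)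
    also have "\<dots> = (\<Sum>(W, X)\<in>?Q \<times> insert {} ?X. real (card W) + real (card X))"
    proof (intro sum.cong refl, clarify)
      fix W X assume "W \<in> ?Q" "X \<in> insert {} ?X"
      then have sub: "W \<subseteq> vset q" "X \<subseteq> vset x"
        using rooted_sets_subset by blast+
      then have "finite W" "finite X"
        using finite_subset finite_vset by blast+
      moreover have "W \<inter> X = {}" using sub disj by blast
      ultimately show "real (card (W \<union> X)) = real (card W) + real (card X)"
        by (simp add: card_Un_disjoint)
    qed
    also have "\<dots> = (\<Sum>W\<in>?Q. \<Sum>X\<in>insert {} ?X. real (card W) + real (card X))"
      by (rule sum.cartesian_product[symmetric])
    also have "\<dots> = (\<Sum>W\<in>?Q. real (card W) * (1 + real (card ?X)) + (\<Sum>X\<in>?X. real (card X)))"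
      using fin empty by (simp add: sum.distrib algebra_simps)
    finally show ?thesis
      by (simp add: sum.distrib sum_distrib_right)
  qed
  ultimately show ?case
    using Graft by simp
qed

section \<open>Trees as symmetric relations\<close>

text \<open>Acyclicity is expressed by every edge being a bridge.\<close>

definition tree_rel :: "'a set \<Rightarrow> 'a rel \<Rightarrow> bool" where
  "tree_rel V E \<longleftrightarrow> finite V \<and> V \<noteq> {} \<and> E \<subseteq> V \<times> V \<and> sym E \<and>
     (\<forall>u\<in>V. \<forall>v\<in>V. (u, v) \<in> E\<^sup>*) \<and>
     (\<forall>u v. (u, v) \<in> E \<longrightarrow> (u, v) \<notin> (E - {(u, v), (v, u)})\<^sup>*)"

section \<open>Edge relations of rooted trees are trees\<close>

lemma root_reaches_vset: "u \<in> vset t \<Longrightarrow> (root_of t, u) \<in> (edges t)\<^sup>*"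
proof (induction t)
  case (Graft q x)
  have mono: "(edges q)\<^sup>* \<subseteq> (edges (Graft q x))\<^sup>*" "(edges x)\<^sup>* \<subseteq> (edges (Graft q x))\<^sup>*"
    by (intro rtrancl_mono; auto)+
  show ?case
  proof (cases "u \<in> vset q")
    case True
    with Graft.IH(1) mono(1) show ?thesis by auto
  next
    case False
    with Graft mono(2) have "(root_of x, u) \<in> (edges (Graft q x))\<^sup>*" by auto
    moreover have "(root_of q, root_of x) \<in> edges (Graft q x)" by simp
    ultimately show ?thesis
      by (metis converse_rtrancl_into_rtrancl root_of.simps(2))
  qed
qed simp

text \<open>A detour around an edge inside one part retracts to a detour within that part,
  contradicting induction. Without the joining edge no walk passes between the parts.\<close>

lemma edges_bridge:
  assumes "distinct_labels t" "(u, v) \<in> edges t"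
  shows "(u, v) \<notin> (edges t - {(u, v), (v, u)})\<^sup>*"
  using assms
proof (induction t)
  case (Graft q x)
  have disj: "vset q \<inter> vset x = {}"
    using Graft.prems by simp
  then have roots: "root_of q \<notin> vset x" "root_of x \<notin> vset q"
    using root_of_in_vset[of q] root_of_in_vset[of x] by blast+
  note sub = edges_subset[of q] edges_subset[of x]
  let ?F = "edges (Graft q x) - {(u, v), (v, u)}"
  let ?f = "\<lambda>u. if u \<in> vset q then u else root_of q"
  let ?g = "\<lambda>u. if u \<in> vset x then u else root_of x"
  consider "(u, v) \<in> edges q" | "(u, v) \<in> edges x" | "{u, v} = {root_of q, root_of x}"
    using Graft.prems by auto
  then show ?case
  proof cases
    case 1
    show ?thesis
    proof
      assume "(u, v) \<in> ?F\<^sup>*"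
      then have "(?f u, ?f v) \<in> (edges q - {(u, v), (v, u)})\<^sup>*"
      proof (rule rtrancl_map)
        fix a b assume "(a, b) \<in> ?F"
        then show "(?f a, ?f b) \<in> (edges q - {(u, v), (v, u)})\<^sup>*"
          using disj sub roots by auto
      qed
      moreover have "u \<in> vset q" "v \<in> vset q" using 1 sub by auto
      ultimately show False using Graft.IH(1) Graft.prems 1 by auto
    qed
  next
    case 2
    show ?thesis
    proof
      assume "(u, v) \<in> ?F\<^sup>*"
      then have "(?g u, ?g v) \<in> (edges x - {(u, v), (v, u)})\<^sup>*"
      proof (rule rtrancl_map)
        fix a b assume "(a, b) \<in> ?F"
        then show "(?g a, ?g b) \<in> (edges x - {(u, v), (v, u)})\<^sup>*"
          using disj sub roots by auto
      qed
      moreover have "u \<in> vset x" "v \<in> vset x" using 2 sub by auto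
      ultimately show False using Graft.IH(2) Graft.prems 2 by auto
    qed
  next
    case 3
    have F: "?F \<subseteq> edges q \<union> edges x"
      using 3 by (auto simp: doubleton_eq_iff)
    show ?thesis
    proof
      assume "(u, v) \<in> ?F\<^sup>*"
      \<comment> \<open>Membership in \<open>vset q\<close> is constant along the remaining edges,
        so its values at \<open>u\<close> and \<open>v\<close> are related by the closure of the
        empty relation, that is, equal.\<close>
      then have "(u \<in> vset q, v \<in> vset q) \<in> {}\<^sup>*"
        by (rule rtrancl_map[where f = "\<lambda>w. w \<in> vset q"]) (use F sub disj in auto)
      then have "u \<in> vset q \<longleftrightarrow> v \<in> vset q" by simp
      with 3 disj root_of_in_vset[of q] root_of_in_vset[of x] show False
        by (auto simp: doubleton_eq_iff)
    qed
  qed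
qed simp

lemma tree_rel_edges:
  assumes "distinct_labels t"
  shows "tree_rel (vset t) (edges t)"
proof -
  have "(u, v) \<in> (edges t)\<^sup>*" if "u \<in> vset t" "v \<in> vset t" for u v
  proof -
    have "(u, root_of t) \<in> (edges t)\<^sup>*"
      using root_reaches_vset[OF that(1)] sym_rtrancl[OF sym_edges] by (metis symD)
    then show ?thesis
      using root_reaches_vset[OF that(2)] by simp
  qed
  moreover have "vset t \<noteq> {}"
    using root_of_in_vset by blast
  ultimately show ?thesis
    using edges_bridge[OF assms] edges_subset[of t] sym_edges[of t] by (auto simp: tree_rel_def)
qed

section \<open>Every tree relation comes from a rooted tree\<close>

lemma rtrancl_closed_restrict:
  assumes "(u, v) \<in> E\<^sup>*" "u \<in> U" "\<And>a b. (a, b) \<in> E \<Longrightarrow> a \<in> U \<Longrightarrow> b \<in> U"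
  shows "v \<in> U \<and> (u, v) \<in> (E \<inter> U \<times> U)\<^sup>*"
  using assms(1)
proof (induction rule: rtrancl_induct)
  case (step y z)
  then have "(y, z) \<in> E \<inter> U \<times> U" using assms(3) by blast
  with step.IH show ?case by (auto intro: rtrancl_into_rtrancl)
qed (use assms(2) in simp)

text \<open>In the application \<open>E\<close> arises from a tree \<open>E'\<close> by deleting an
  edge. A bridge of \<open>E'\<close> remains a bridge in any smaller relation containing
  it.\<close>

lemma tree_rel_component:
  assumes "finite V" "sym E" "E \<subseteq> V \<times> V" "r \<in> V" "E \<subseteq> E'"
    and bridge: "\<And>u v. (u, v) \<in> E' \<Longrightarrow> (u, v) \<notin> (E' - {(u, v), (v, u)})\<^sup>*"
  defines "U \<equiv> {v. (r, v) \<in> E\<^sup>*}"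
  shows "U \<subseteq> V" "tree_rel U (E \<inter> U \<times> U)"
proof -
  have step: "b \<in> U" if "(a, b) \<in> E" "a \<in> U" for a b
    using that by (auto simp: U_def intro: rtrancl_into_rtrancl)
  show UV: "U \<subseteq> V"
    unfolding U_def using assms(3,4) by (auto elim: rtranclE)
  have symU: "sym (E \<inter> U \<times> U)"
    using assms(2) by (auto simp: sym_def)
  have "(r, u) \<in> (E \<inter> U \<times> U)\<^sup>*" if "u \<in> U" for u
    using rtrancl_closed_restrict[of r u E U] step that by (auto simp: U_def)
  then have "(u, v) \<in> (E \<inter> U \<times> U)\<^sup>*" if "u \<in> U" "v \<in> U" for u v
    using that sym_rtrancl[OF symU] by (meson rtrancl_trans symD)
  moreover have "(u, v) \<notin> (E \<inter> U \<times> U - {(u, v), (v, u)})\<^sup>*" if "(u, v) \<in> E" for u v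
  proof
    assume *: "(u, v) \<in> (E \<inter> U \<times> U - {(u, v), (v, u)})\<^sup>*"
    have "E \<inter> U \<times> U - {(u, v), (v, u)} \<subseteq> E' - {(u, v), (v, u)}"
      using assms(5) by auto
    then have "(u, v) \<in> (E' - {(u, v), (v, u)})\<^sup>*"
      using * rtrancl_mono by blast
    with bridge that assms(5) show False by blast
  qed
  moreover have "r \<in> U" by (simp add: U_def)
  ultimately show "tree_rel U (E \<inter> U \<times> U)"
    using symU finite_subset[OF UV assms(1)] unfolding tree_rel_def by blast
qed

text \<open>Deleting an edge at \<open>r\<close> leaves two components. Both are smaller trees, and
  grafting the rooted trees obtained for them restores the edge.\<close>

lemma tree_rel_obtains_rtree:
  assumes "tree_rel V E" "r \<in> V"
  obtains t where "distinct_labels t" "root_of t = r" "vset t = V" "edges t = E"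
  using assms
proof (induction "card V" arbitrary: V E r thesis rule: less_induct)
  case less
  have fin: "finite V" and EV: "E \<subseteq> V \<times> V" and sym: "sym E"
    and conn: "\<And>u v. u \<in> V \<Longrightarrow> v \<in> V \<Longrightarrow> (u, v) \<in> E\<^sup>*"
    and bridge: "\<And>u v. (u, v) \<in> E \<Longrightarrow> (u, v) \<notin> (E - {(u, v), (v, u)})\<^sup>*"
    using less.prems(2) by (auto simp: tree_rel_def)
  \<comment> \<open>A loop is never a bridge, since the closure is reflexive.\<close>
  have irrefl: "(u, u) \<notin> E" for u
    using bridge[of u u] by auto
  show ?case
  proof (cases "V = {r}")
    case True
    with EV irrefl have "E = {}" by auto
    with True show ?thesis by (intro less.prems(1)[of "Single r"]) auto
  next
    case False
    with less.prems(3) obtain u where "u \<in> V" "u \<noteq> r" by blast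
    with conn[of r u] less.prems(3) obtain x where rx: "(r, x) \<in> E"
      by (auto elim: converse_rtranclE)
    then have xV: "x \<in> V" using EV by auto
    define F where "F = E - {(r, x), (x, r)}"
    define Q X where "Q = {v. (r, v) \<in> F\<^sup>*}" and "X = {v. (x, v) \<in> F\<^sup>*}"
    have symF: "sym F" and FV: "F \<subseteq> V \<times> V" and FE: "F \<subseteq> E"
      using sym EV by (auto simp: F_def sym_def)
    have Q: "Q \<subseteq> V" "tree_rel Q (F \<inter> Q \<times> Q)"
      unfolding Q_def using tree_rel_component[OF fin symF FV less.prems(3) FE] bridge by auto
    have X: "X \<subseteq> V" "tree_rel X (F \<inter> X \<times> X)"
      unfolding X_def using tree_rel_component[OF fin symF FV xV FE] bridge by auto
    have disj: "Q \<inter> X = {}"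
    proof (rule ccontr)
      assume "Q \<inter> X \<noteq> {}"
      then obtain v where "(r, v) \<in> F\<^sup>*" "(x, v) \<in> F\<^sup>*"
        by (auto simp: Q_def X_def)
      then have "(r, x) \<in> F\<^sup>*"
        using sym_rtrancl[OF symF] by (meson rtrancl_trans symD)
      with bridge[OF rx] show False by (simp add: F_def)
    qed
    have rQ: "r \<in> Q" and xX: "x \<in> X"
      by (auto simp: Q_def X_def)
    have V: "V = Q \<union> X"
    proof
      show "V \<subseteq> Q \<union> X"
      proof
        fix v assume "v \<in> V"
        then have "(r, v) \<in> E\<^sup>*" using conn less.prems(3) by blast
        then show "v \<in> Q \<union> X"
        proof (induction rule: rtrancl_induct)
          case (step y z)
          show ?case
          proof (cases "(y, z) \<in> F")
            case True
            with step.IH show ?thesis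
              by (auto simp: Q_def X_def intro: rtrancl_into_rtrancl)
          next
            case False
            \<comment> \<open>A step along the deleted edge ends in \<open>r\<close> or in
              \<open>x\<close>.\<close>
            with step.hyps rQ xX show ?thesis by (auto simp: F_def)
          qed
        qed (use rQ in simp)
      qed
    qed (use Q X in blast)
    have "card Q < card V" "card X < card V"
      using V disj rQ xX fin by (auto intro!: psubset_card_mono)
    then obtain q t where q: "distinct_labels q" "root_of q = r" "vset q = Q" "edges q = F \<inter> Q \<times> Q"
      and t: "distinct_labels t" "root_of t = x" "vset t = X" "edges t = F \<inter> X \<times> X"
      using less.hyps[OF _ _ Q(2) rQ] less.hyps[OF _ _ X(2) xX] by metis
    have "(a, b) \<in> Q \<times> Q \<union> X \<times> X" if ab: "(a, b) \<in> F" for a b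
    proof -
      have "a \<in> V" using ab FV by auto
      moreover have "a \<in> Q \<Longrightarrow> b \<in> Q" "a \<in> X \<Longrightarrow> b \<in> X"
        using ab by (auto simp: Q_def X_def intro: rtrancl_into_rtrancl)
      ultimately show ?thesis using V by blast
    qed
    then have "F \<subseteq> Q \<times> Q \<union> X \<times> X"
      by (rule subrelI)
    then have "F = F \<inter> Q \<times> Q \<union> F \<inter> X \<times> X"
      by blast
    then have "edges (Graft q t) = E"
      using q t rx symD[OF sym rx] by (auto simp: F_def)
    with q t V disj show ?thesis
      by (intro less.prems(1)[of "Graft q t"]) auto
  qed
qed

section \<open>Undirected trees\<close>

text \<open>The predicate \<open>connected\<close> refers to the symmetric closure, which here is
  \<open>G\<close> itself.\<close>

lemma connected_with_proj_iff:
  assumes "sym (parcs G)" "parcs G \<subseteq> pverts G \<times> pverts G"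
  shows "connected (with_proj G) \<longleftrightarrow>
    pverts G \<noteq> {} \<and> (\<forall>u\<in>pverts G. \<forall>v\<in>pverts G. (u, v) \<in> (parcs G)\<^sup>*)"
proof -
  interpret pair_wf_digraph G
    using assms(2) by unfold_locales auto
  have "parcs (mk_symmetric (with_proj G)) = parcs G"
    using assms(1) by (auto simp: parcs_mk_symmetric dest: symD)
  then have mk: "mk_symmetric (with_proj G) = G"
    by (simp add: mk_symmetric_def)
  have "reachable (with_proj G) u v \<longleftrightarrow> (u, v) \<in> (parcs G)\<^sup>*" if "u \<in> pverts G" "v \<in> pverts G" for u v
    using reachable_conv[of u v] that by simp
  then show ?thesis
    unfolding connected_def strongly_connected_def mk by simp
qed

lemma pair_graph_iff:
  "pair_graph G \<longleftrightarrow> finite (pverts G) \<and> parcs G \<subseteq> pverts G \<times> pverts G \<and> sym (parcs G) \<and>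
     (\<forall>u. (u, u) \<notin> parcs G)"
proof
  assume "pair_graph G"
  then interpret pair_graph G .
  show "finite (pverts G) \<and> parcs G \<subseteq> pverts G \<times> pverts G \<and> sym (parcs G) \<and>
     (\<forall>u. (u, u) \<notin> parcs G)"
    using pair_finite_verts in_arcsD1 in_arcsD2 arcs_symmetric no_loops'
    by (auto intro!: symI) blast
next
  assume *: "finite (pverts G) \<and> parcs G \<subseteq> pverts G \<times> pverts G \<and> sym (parcs G) \<and>
     (\<forall>u. (u, u) \<notin> parcs G)"
  then have "finite (parcs G)"
    by (auto intro: finite_subset)
  with * show "pair_graph G"
    by unfold_locales (auto simp: symmetric_def)
qed

section \<open>Cycles versus bridges\<close>

lemma pcas_rtrancl:
  assumes "pcas u p v" "set p \<subseteq> E"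
  shows "(u, v) \<in> E\<^sup>*"
  using assms
proof (induction p arbitrary: u)
  case (Cons e p)
  then have "(u, snd e) \<in> E" "(snd e, v) \<in> E\<^sup>*"
    by (cases e; auto)+
  then show ?case by (rule converse_rtrancl_into_rtrancl)
qed simp

lemma pawalk_verts_pcas: "pcas u p v \<Longrightarrow> pawalk_verts u p = u # map snd p"
  by (induction p arbitrary: u) auto

lemma pcas_snoc: "pcas u (p @ [(a, b)]) v \<longleftrightarrow> pcas u p a \<and> b = v"
  by (induction p arbitrary: u) auto

lemma pcas_end_in: "pcas u p v \<Longrightarrow> p \<noteq> [] \<Longrightarrow> v \<in> snd ` set p"
proof (induction p arbitrary: u)
  case (Cons e p)
  then show ?case by (cases p) auto
qed simp

text \<open>If an edge is not a bridge, a path joining its ends without it is closed by the edge to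
  a cycle.\<close>

lemma undirected_treeD:
  assumes "undirected_tree G"
  shows "tree_rel (pverts G) (parcs G)"
proof -
  have G: "finite (pverts G)" "parcs G \<subseteq> pverts G \<times> pverts G" "sym (parcs G)"
    "\<And>u. (u, u) \<notin> parcs G"
    using assms by (auto simp: undirected_tree_def pair_graph_iff)
  then interpret G: pair_wf_digraph G
    by unfold_locales auto
  have "(u, v) \<notin> (parcs G - {(u, v), (v, u)})\<^sup>*" if uv: "(u, v) \<in> parcs G" for u v
  proof
    assume reach: "(u, v) \<in> (parcs G - {(u, v), (v, u)})\<^sup>*"
    define H where "H = \<lparr>pverts = pverts G, parcs = parcs G - {(u, v), (v, u)}\<rparr>"
    then have parcs_H: "parcs H = parcs G - {(u, v), (v, u)}"
      by simp
    interpret H: pair_wf_digraph H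
      using G(2) by unfold_locales (auto simp: H_def)
    have V: "u \<in> pverts G" "v \<in> pverts G" and "u \<noteq> v"
      using uv G by auto
    then have "reachable (with_proj H) u v"
      using reach H.reachable_conv[of u v] by (simp add: H_def)
    then obtain p where p: "H.apath u p v"
      using H.reachable_apath by blast
    then have cas: "pcas u p v" and sub: "set p \<subseteq> parcs G - {(u, v), (v, u)}"
      and dist: "distinct (pawalk_verts u p)"
      by (auto simp: H.apath_def H.awalk_def parcs_H)
    \<comment> \<open>The ends differ and the arc \<open>(u, v)\<close> is deleted, so one arc
      cannot suffice. The closed walk thus has length at least 3.\<close>
    have "length p \<ge> 2"
    proof (rule ccontr)
      assume "\<not> length p \<ge> 2"
      then have "p = [] \<or> (\<exists>e. p = [e])"
        by (cases p; cases "tl p") auto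
      then show False
        using cas sub \<open>u \<noteq> v\<close> by auto
    qed
    moreover have cas': "pcas u (p @ [(v, u)]) u"
      using cas by (simp only: pcas_snoc)
    \<comment> \<open>Dropping the initial \<open>u\<close> and appending it at the end only rotates
      the vertex sequence of the path.\<close>
    have dist': "distinct (tl (pawalk_verts u (p @ [(v, u)])))"
      using dist unfolding pawalk_verts_pcas[OF cas'] pawalk_verts_pcas[OF cas] by simp
    have "G.cycle (p @ [(v, u)])"
      unfolding G.cycle_def G.awalk_def
      using cas' V sub symD[OF G(3) uv] dist' by (intro exI[of _ u]) auto
    ultimately show False
      using assms by (auto simp: undirected_tree_def intro: exI[of _ "p @ [(v, u)]"])
  qed
  then show ?thesis
    using assms G connected_with_proj_iff[OF G(3,2)]
    by (simp add: tree_rel_def undirected_tree_def)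
qed

text \<open>After the first arc \<open>(u, v)\<close> of a cycle of length at least 3, the rest
  leads back from \<open>v\<close> to \<open>u\<close> without using this edge, so the edge is not a
  bridge.\<close>

lemma undirected_treeI:
  assumes "tree_rel (pverts G) (parcs G)"
  shows "undirected_tree G"
proof -
  have G: "finite (pverts G)" "pverts G \<noteq> {}" "parcs G \<subseteq> pverts G \<times> pverts G" "sym (parcs G)"
    and conn: "\<forall>u\<in>pverts G. \<forall>v\<in>pverts G. (u, v) \<in> (parcs G)\<^sup>*"
    and bridge: "\<And>u v. (u, v) \<in> parcs G \<Longrightarrow> (u, v) \<notin> (parcs G - {(u, v), (v, u)})\<^sup>*"
    using assms by (auto simp: tree_rel_def)
  then interpret G: pair_wf_digraph G
    by unfold_locales auto
  have irrefl: "(u, u) \<notin> parcs G" for u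
    using bridge[of u u] by auto
  have False if cyc: "G.cycle p" and len: "3 \<le> length p" for p
  proof -
    obtain u where walk: "G.awalk u p u" and dist: "distinct (tl (pawalk_verts u p))"
      using cyc by (auto simp: G.cycle_def)
    obtain v es where p: "p = (u, v) # es"
      using walk len by (cases p) (auto simp: G.awalk_def)
    have cas: "pcas v es u" and sub: "set es \<subseteq> parcs G" and uv: "(u, v) \<in> parcs G"
      using walk by (auto simp: G.awalk_def p)
    have dist': "distinct (map snd es)" "v \<notin> snd ` set es"
      using dist by (auto simp: p pawalk_verts_pcas[OF cas])
    obtain es' a b where es: "es = es' @ [(a, b)]"
      using len by (cases es rule: rev_cases) (auto simp: p)
    have "pcas v es' a" and b: "b = u"
      using cas by (auto simp: es pcas_snoc)
    \<comment> \<open>Since \<open>es\<close> has at least two arcs, \<open>a\<close> is the head of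
      an arc of \<open>es'\<close>, while \<open>v\<close> is the head of none in \<open>es\<close>.
      The only arc of \<open>es\<close> into \<open>u\<close> is therefore not
      \<open>(v, u)\<close>.\<close>
    then have "a \<in> snd ` set es'"
      using len by (intro pcas_end_in) (auto simp: p es)
    then have "a \<noteq> v"
      using dist'(2) by (auto simp: es)
    then have "(v, u) \<notin> set es"
      using dist'(1) b by (force simp: es)
    moreover have "(u, v) \<notin> set es"
      using dist'(2) by force
    ultimately have "(v, u) \<in> (parcs G - {(v, u), (u, v)})\<^sup>*"
      using sub by (intro pcas_rtrancl[OF cas]) auto
    with bridge symD[OF G(4) uv] show False by blast
  qed
  then show ?thesis
    using G conn irrefl connected_with_proj_iff[OF G(4,3)]
    by (auto simp: undirected_tree_def pair_graph_iff)
qed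

section \<open>Subtrees and local mean of the graph of a rooted tree\<close>

lemma induced_subgraph_with_proj_iff:
  assumes "parcs G \<subseteq> pverts G \<times> pverts G"
  shows "induced_subgraph (with_proj S) (with_proj G) \<longleftrightarrow>
    pverts S \<subseteq> pverts G \<and> parcs S = parcs G \<inter> pverts S \<times> pverts S"
proof -
  have wf: "pair_wf_digraph H" if "parcs H \<subseteq> pverts H \<times> pverts H" for H :: "'a pair_pre_digraph"
    using that by unfold_locales auto
  have "pair_wf_digraph S" if "parcs S = parcs G \<inter> pverts S \<times> pverts S"
    by (rule wf) (use that in blast)
  moreover have "{e \<in> parcs G. fst e \<in> pverts S \<and> snd e \<in> pverts S} = parcs G \<inter> pverts S \<times> pverts S"
    by auto
  ultimately show ?thesis
    unfolding induced_subgraph_def subgraph_def wf_digraph_wp_iff with_proj_simps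
    using wf[OF assms] by blast
qed

text \<open>An induced subgraph is determined by its vertex set, so sums over subtrees become sums
  over \<open>rooted_sets\<close>.\<close>

lemma subtrees_to_graph:
  "{S \<in> subtrees (to_graph t). root_of t \<in> pverts S} =
    (\<lambda>W. \<lparr>pverts = W, parcs = edges t \<inter> W \<times> W\<rparr>) ` rooted_sets (edges t) (root_of t)"
proof (intro equalityI subsetI)
  fix S assume S: "S \<in> {S \<in> subtrees (to_graph t). root_of t \<in> pverts S}"
  then have arcs: "parcs S = edges t \<inter> pverts S \<times> pverts S"
    using edges_subset[of t] by (auto simp: subtrees_def induced_subgraph_with_proj_iff)
  have "sym (parcs S)"
    using sym_edges[of t] unfolding arcs by (auto simp: sym_def)
  then have "pverts S \<in> rooted_sets (edges t) (root_of t)"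
    using S arcs connected_with_proj_iff[of S] by (auto simp: subtrees_def rooted_sets_def)
  with arcs show "S \<in> (\<lambda>W. \<lparr>pverts = W, parcs = edges t \<inter> W \<times> W\<rparr>) ` rooted_sets (edges t) (root_of t)"
    by (intro image_eqI[of _ _ "pverts S"]) auto
next
  fix S assume "S \<in> (\<lambda>W. \<lparr>pverts = W, parcs = edges t \<inter> W \<times> W\<rparr>) ` rooted_sets (edges t) (root_of t)"
  then obtain W where W: "W \<in> rooted_sets (edges t) (root_of t)"
    and S: "S = \<lparr>pverts = W, parcs = edges t \<inter> W \<times> W\<rparr>"
    by blast
  have sym: "sym (edges t \<inter> W \<times> W)"
    using sym_edges[of t] by (auto simp: sym_def)
  have r: "root_of t \<in> W" and reach: "\<And>u. u \<in> W \<Longrightarrow> (root_of t, u) \<in> (edges t \<inter> W \<times> W)\<^sup>*"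
    using W by (auto simp: rooted_sets_def)
  have "(u, v) \<in> (edges t \<inter> W \<times> W)\<^sup>*" if "u \<in> W" "v \<in> W" for u v
    using reach that sym_rtrancl[OF sym] by (meson rtrancl_trans symD)
  with r have "connected (with_proj S)"
    using sym connected_with_proj_iff[of S] by (auto simp: S)
  then show "S \<in> {S \<in> subtrees (to_graph t). root_of t \<in> pverts S}"
    using r rooted_sets_subset[OF W] edges_subset[of t]
    by (simp add: subtrees_def induced_subgraph_with_proj_iff S)
qed

lemma local_mean_to_graph:
  assumes "distinct_labels t"
  shows "local_mean_subtree_order (to_graph t) (root_of t) = tot t / num t"
proof -
  have "inj_on (\<lambda>W. \<lparr>pverts = W, parcs = edges t \<inter> W \<times> W\<rparr>) A" for A
    by (rule inj_onI) simp
  then show ?thesis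
    using card_rooted_sets[OF assms]
    by (simp add: local_mean_subtree_order_def subtrees_to_graph card_image sum.reindex)
qed

theorem theorem1p3:
  fixes T :: "'a pair_pre_digraph" and r :: 'a and n :: nat
  assumes "n \<ge> 1"
    and "undirected_tree T" and "card (pverts T) = n" and "r \<in> pverts T"
    and "\<And>(T' :: 'a pair_pre_digraph) r'.
           undirected_tree T' \<Longrightarrow> card (pverts T') = n \<Longrightarrow> r' \<in> pverts T' \<Longrightarrow>
           local_mean_subtree_order T' r' \<le> local_mean_subtree_order T r"
  shows "\<exists>xs L. broom T xs L \<and> r = hd xs"
proof -
  have "tree_rel (pverts T) (parcs T)"
    using assms(2) by (rule undirected_treeD)
  then obtain t where t: "distinct_labels t" "root_of t = r" "vset t = pverts T" "edges t = parcs T"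
    using tree_rel_obtains_rtree assms(4) by metis
  then have T: "T = to_graph t"
    by (simp add: to_graph_def)
  \<comment> \<open>At this value the functional vanishes on \<open>t\<close>. It is nonpositive on
    every competitor, whose mean is at most \<mu>.\<close>
  define \<mu> where "\<mu> = tot t / num t"
  have "tot t' - \<mu> * num t' \<le> tot t - \<mu> * num t"
    if t': "distinct_labels t'" "vset t' = vset t" for t'
  proof -
    have "undirected_tree (to_graph t')"
      using tree_rel_edges[OF t'(1)] by (simp add: undirected_treeI)
    then have "local_mean_subtree_order (to_graph t') (root_of t') \<le> local_mean_subtree_order T r"
      using assms(3) t'(2) t(3) by (intro assms(5)) auto
    then have "tot t' / num t' \<le> \<mu>"
      using local_mean_to_graph[OF t(1)] local_mean_to_graph[OF t'(1)] T t(2)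
      by (simp add: \<mu>_def)
    then show ?thesis
      using num_ge_1[of t] num_ge_1[of t'] by (simp add: \<mu>_def divide_le_eq)
  qed
  then have "maximal \<mu> t"
    using t(1) by (simp add: maximal_def)
  then show ?thesis
    using broom_to_graph[OF maximal_imp_broom_tree t(1)] T t(2) by metis
qed

end
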